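(* Let $f:\mathbb{R}^n\to\mathbb{R}$ be twice continuously differentiable. Consider the problem $(\mathrm{P_{1a}})$ of minimizing $f(x)$ over $x\in\Delta_n$, and the problem $(\mathrm{P_{1b}})$ of minimizing $g(z)=f(z\odot z)$ over $z\in\mathcal{S}_{n-1}$. Then: 1. If $x^\star$ is a second-order KKT point of $(\mathrm{P_{1a}})$, then every $z^\star\in\mathbb{R}^n$ with $z^\star\odot z^\star=x^\star$ is a second-order KKT point of $(\mathrm{P_{1b}})$. 2. Conversely, if $z^\star$ is a second-order KKT point of $(\mathrm{P_{1b}})$, then $x^\star=z^\star\odot z^\star$ is a second-order KKT point of $(\mathrm{P_{1a}})$.
   Context: Notation: $[x]_i$ is the $i$th entry of $x$; $\odot$ is the entrywise product; $1_n$ is the all-ones vector in $\mathbb{R}^n$; vector inequalities are entrywise; $\Delta_n=\{x\in\mathbb{R}^n: 1_n^\top x=1,\ x\ge 0\}$; $\mathcal{S}_{n-1}=\{z\in\mathbb{R}^n:\|z\|_2=1\}$. A point $x^\star$ is a second-order KKT point of $(\mathrm{P_{1a}})$ if (first-order conditions) there exist $\lambda^\star\in\mathbb{R}$, $\beta^\star\in\mathbb{R}^n$ with $\nabla f(x^\star)=\lambda^\star 1_n+\beta^\star$, $x^\star\ge 0$, $\beta^\star\ge 0$, $x^\star\odot\beta^\star=0$, $1_n^\top x^\star=1$; and (second-order condition) $u^\top\nabla^2 f(x^\star)u\ge 0$ for all $u\in\mathbb{R}^n$ with $1_n^\top u=0$ and $[u]_i=0$ whenever $[x^\star]_i=0$.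 A point $z^\star$ is a second-order KKT point of $(\mathrm{P_{1b}})$ if there exists $\lambda_N^\star\in\mathbb{R}$ with $\nabla f(z^\star\odot z^\star)\odot z^\star=\lambda_N^\star z^\star$, $\|z^\star\|_2^2=1$, and, for all $d\in\mathbb{R}^n$ with $d\perp z^\star$, $$2\langle\nabla f(z^\star\odot z^\star),d\odot d\rangle-2\lambda_N^\star\|d\|_2^2+4(z^\star\odot d)^\top\nabla^2 f(z^\star\odot z^\star)(z^\star\odot d)\ge 0.$$ *)

theory Defs
  imports "HOL-Analysis.Analysis"
begin

text \<open>On \<^typ>\<open>real ^ 'n\<close> the library operations \<open>*\<close>, \<open>1\<close> and \<open>\<le>\<close> are entrywise: they are the
  entrywise product, the all-ones vector and the entrywise order.\<close>

definition gradient :: "(real ^ 'n \<Rightarrow> real) \<Rightarrow> real ^ 'n \<Rightarrow> real ^ 'n" where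
  "gradient f x = (\<chi> i. frechet_derivative f (at x) (axis i 1))"

definition hessian :: "(real ^ 'n \<Rightarrow> real) \<Rightarrow> real ^ 'n \<Rightarrow> real ^ 'n ^ 'n" where
  "hessian f x = jacobian (gradient f) (at x)"

lemma GDERIV_gradient:
  fixes f :: "real ^ 'n \<Rightarrow> real"
  assumes "f differentiable (at x)"
  shows "GDERIV f x :> gradient f x"
proof -
  have d: "(f has_derivative frechet_derivative f (at x)) (at x)"
    using assms by (simp add: frechet_derivative_works)
  then interpret linear "frechet_derivative f (at x)"
    by (rule has_derivative_linear)
  have "frechet_derivative f (at x) h = inner h (gradient f x)" for h
  proof -
    have "frechet_derivative f (at x) h
        = frechet_derivative f (at x) (\<Sum>i\<in>UNIV. (h $ i) *\<^sub>R axis i 1)"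
      using basis_expansion[of h] by (simp add: scalar_mult_eq_scaleR)
    also have "\<dots> = inner h (gradient f x)"
      by (simp add: sum scaleR inner_vec_def gradient_def)
    finally show ?thesis .
  qed
  then have "frechet_derivative f (at x) = (\<lambda>h. inner h (gradient f x))"
    by (rule ext)
  with d show ?thesis
    by (simp add: gderiv_def)
qed

definition twice_continuously_differentiable :: "(real ^ 'n \<Rightarrow> real) \<Rightarrow> bool" where
  "twice_continuously_differentiable f \<longleftrightarrow>
     (\<forall>x. f differentiable (at x)) \<and>
     (\<forall>x. gradient f differentiable (at x)) \<and>
     continuous_on UNIV (hessian f)"

text \<open>Second-order KKT points of the problem of minimizing \<open>f\<close> over the unit simplex.\<close>

definition second_order_KKT_simplex :: "(real ^ 'n \<Rightarrow> real) \<Rightarrow> real ^ 'n \<Rightarrow> bool" where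
  "second_order_KKT_simplex f x \<longleftrightarrow>
     (\<exists>(l::real) (b :: real ^ 'n).
        gradient f x = l *\<^sub>R 1 + b \<and> 0 \<le> x \<and> 0 \<le> b \<and> x * b = 0 \<and> inner 1 x = 1) \<and>
     (\<forall>u :: real ^ 'n. inner 1 u = 0 \<longrightarrow> (\<forall>i. x $ i = 0 \<longrightarrow> u $ i = 0) \<longrightarrow>
        0 \<le> inner u (hessian f x *v u))"

text \<open>Second-order KKT points of the problem of minimizing \<open>f (z * z)\<close> over the unit sphere,
  expressed through the gradient and the Hessian of \<open>f\<close>. The same multiplier \<open>l\<close> occurs in the
  first-order and in the second-order condition.\<close>

definition second_order_KKT_sphere :: "(real ^ 'n \<Rightarrow> real) \<Rightarrow> real ^ 'n \<Rightarrow> bool" where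
  "second_order_KKT_sphere f z \<longleftrightarrow>
     (\<exists>l::real.
        gradient f (z * z) * z = l *\<^sub>R z \<and> (norm z)\<^sup>2 = 1 \<and>
        (\<forall>d. orthogonal d z \<longrightarrow>
           0 \<le> 2 * inner (gradient f (z * z)) (d * d) - 2 * l * (norm d)\<^sup>2
                + 4 * inner (z * d) (hessian f (z * z) *v (z * d))))"

end

theory Submission
  imports Defs
begin

text \<open>Both conditions depend on \<open>f\<close> only through the vector \<open>g\<close> and the matrix \<open>H\<close>, its gradient and
  Hessian at \<open>z \<odot> z\<close>; the multipliers are related by \<open>b = g - l 1\<close>, and directions by \<open>u = z \<odot> d\<close>.
  The sphere curvature is \<open>2 \<Sum>\<^sub>i b\<^sub>i d\<^sub>i\<^sup>2 + 4 u\<^sup>T H u\<close>. From simplex to sphere the first sum is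
  nonnegative because \<open>b \<ge> 0\<close>. Conversely, coordinate directions \<open>d = e\<^sub>i\<close> with \<open>z\<^sub>i = 0\<close> make
  \<open>u\<close> vanish and give \<open>b\<^sub>i \<ge> 0\<close>, and a feasible \<open>u\<close> is lifted to \<open>d\<^sub>i = u\<^sub>i / z\<^sub>i\<close>, supported where
  \<open>b\<close> vanishes.\<close>

text \<open>Exposes the entries of \<open>b = g - l *\<^sub>R 1\<close> as weights of squares, so
  that the sign of \<open>b\<close> governs this term.\<close>

lemma sphere_multiplier_term:
  fixes g d :: "real ^ 'n"
  shows "2 * inner g (d * d) - 2 * l * (norm d)\<^sup>2 = 2 * (\<Sum>i\<in>UNIV. (g $ i - l) * (d $ i)\<^sup>2)"
  unfolding power2_norm_eq_inner
  by (simp add: inner_vec_def power2_eq_square sum_distrib_left algebra_simps flip: sum_subtractf)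

lemma norm_power2_eq_inner_one:
  fixes z :: "real ^ 'n"
  shows "(norm z)\<^sup>2 = inner 1 (z * z)"
  unfolding power2_norm_eq_inner by (simp add: inner_vec_def)

text \<open>Turns tangency of \<open>d\<close> to the sphere into tangency of \<open>z * d\<close>
  to the simplex.\<close>

lemma orthogonal_iff_inner_one:
  fixes d z :: "real ^ 'n"
  shows "orthogonal d z \<longleftrightarrow> inner 1 (z * d) = 0"
  by (simp add: orthogonal_def inner_vec_def mult.commute)

lemma simplex_imp_sphere:
  fixes f :: "real ^ 'n \<Rightarrow> real"
  assumes "second_order_KKT_simplex f (z * z)"
  shows "second_order_KKT_sphere f z"
proof -
  obtain l b where g: "gradient f (z * z) = l *\<^sub>R 1 + b" and b: "0 \<le> b"
    and comp: "z * z * b = 0" and one: "inner 1 (z * z) = 1"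
    and H: "\<And>u. inner 1 u = 0 \<Longrightarrow> (\<And>i. (z * z) $ i = 0 \<Longrightarrow> u $ i = 0)
      \<Longrightarrow> 0 \<le> inner u (hessian f (z * z) *v u)"
    using assms unfolding second_order_KKT_simplex_def by blast
  have "b * z = 0"
    using comp by (auto simp: vec_eq_iff)
  then have "gradient f (z * z) * z = l *\<^sub>R z"
    by (auto simp: g vec_eq_iff distrib_right)
  moreover have "0 \<le> 2 * inner (gradient f (z * z)) (d * d) - 2 * l * (norm d)\<^sup>2
      + 4 * inner (z * d) (hessian f (z * z) *v (z * d))" if "orthogonal d z" for d
  proof -
    have "0 \<le> (\<Sum>i\<in>UNIV. (gradient f (z * z) $ i - l) * (d $ i)\<^sup>2)"
      using b by (intro sum_nonneg) (simp add: g less_eq_vec_def)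
    moreover have "0 \<le> inner (z * d) (hessian f (z * z) *v (z * d))"
      using that by (intro H) (auto simp: orthogonal_iff_inner_one)
    ultimately show ?thesis
      unfolding sphere_multiplier_term by simp
  qed
  ultimately show ?thesis
    using one unfolding second_order_KKT_sphere_def norm_power2_eq_inner_one by blast
qed

lemma sphere_imp_simplex:
  fixes f :: "real ^ 'n \<Rightarrow> real"
  assumes "second_order_KKT_sphere f z"
  shows "second_order_KKT_simplex f (z * z)"
proof -
  obtain l where g: "gradient f (z * z) * z = l *\<^sub>R z" and one: "inner 1 (z * z) = 1"
    and H: "\<And>d. orthogonal d z \<Longrightarrow>
      0 \<le> 2 * (\<Sum>i\<in>UNIV. (gradient f (z * z) $ i - l) * (d $ i)\<^sup>2)
        + 4 * inner (z * d) (hessian f (z * z) *v (z * d))"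
    using assms
    unfolding second_order_KKT_sphere_def norm_power2_eq_inner_one[of z] sphere_multiplier_term
    by blast
  define b where "b = gradient f (z * z) - l *\<^sub>R 1"
  have b_nth: "gradient f (z * z) $ i - l = b $ i" for i
    by (simp add: b_def)
  have comp: "b $ i = 0" if "z $ i \<noteq> 0" for i
    using that g by (auto simp: b_def vec_eq_iff)
  have "0 \<le> b $ i" for i
  proof (cases "z $ i = 0")
    case True
    \<comment> \<open>Hence \<open>axis i 1\<close> is orthogonal to \<open>z\<close> and the
      Hessian term drops out, leaving \<open>2 * b $ i\<close>.\<close>
    then have "z * axis i 1 = 0"
      by (simp add: vec_eq_iff axis_def)
    moreover have "(\<Sum>j\<in>UNIV. b $ j * (axis i 1 $ j)\<^sup>2) = b $ i"
      by (simp add: axis_def if_distrib[of "\<lambda>x. x\<^sup>2"] if_distrib[of "(*) _"] cong: if_cong)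
    ultimately show ?thesis
      using H[of "axis i 1"] by (simp add: orthogonal_iff_inner_one b_nth)
  qed (simp add: comp)
  then have "0 \<le> b"
    by (simp add: less_eq_vec_def)
  moreover have "z * z * b = 0"
    using comp by (auto simp: vec_eq_iff)
  moreover have "0 \<le> z * z"
    by (simp add: less_eq_vec_def)
  moreover have "gradient f (z * z) = l *\<^sub>R 1 + b"
    by (simp add: b_def)
  moreover have "0 \<le> inner u (hessian f (z * z) *v u)"
    if u: "inner 1 u = 0" "\<forall>i. (z * z) $ i = 0 \<longrightarrow> u $ i = 0" for u
  proof -
    \<comment> \<open>Division by zero gives \<open>d $ i = 0\<close> wherever \<open>z $ i = 0\<close>.\<close>
    define d where "d = (\<chi> i. u $ i / z $ i)"
    have "z * d = u"
      using u by (auto simp: d_def vec_eq_iff)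
    \<comment> \<open>In each term \<open>b $ i = 0\<close> if \<open>z $ i \<noteq> 0\<close>, and
      \<open>d $ i = 0\<close> otherwise; only the Hessian term of \<open>H\<close>
      survives.\<close>
    moreover have "(\<Sum>i\<in>UNIV. b $ i * (d $ i)\<^sup>2) = 0"
      using comp by (intro sum.neutral) (auto simp: d_def)
    ultimately show ?thesis
      using H[of d] u by (simp add: orthogonal_iff_inner_one b_nth)
  qed
  ultimately show ?thesis
    using one unfolding second_order_KKT_simplex_def by blast
qed

theorem theorem1:
  fixes f :: "real ^ 'n \<Rightarrow> real"
  assumes "twice_continuously_differentiable f"
  shows "(\<forall>x. second_order_KKT_simplex f x \<longrightarrow>
            (\<forall>z. z * z = x \<longrightarrow> second_order_KKT_sphere f z)) \<and>
         (\<forall>z. second_order_KKT_sphere f z \<longrightarrow> second_order_KKT_simplex f (z * z))"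
  using simplex_imp_sphere sphere_imp_simplex by blast

end
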